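(* Let (HD), (LD), (wLD), (sPP), (LP) denote, respectively, the homologous-Desargues, Little-Desargues, weak Little-Desargues, strong perspective Pappus and Little-Pappus properties of a plane of incidence, as defined in the context. Then for every plane of incidence $\Pi$: (1) if $\Pi$ satisfies (HD), then $\Pi$ satisfies (LD); (2) $\Pi$ satisfies (wLD) if and only if $\Pi$ satisfies (sPP); (3) if $\Pi$ satisfies (wLD), then $\Pi$ satisfies (LP). Moreover, (4) in the Euclidean model of the real projective plane (the Euclidean plane extended by its points at infinity and its line at infinity), (LD) can be proved from (wLD); that is, for the real projective plane (wLD) implies (LD).
   Context: A plane of incidence consists of a set of points, a set of lines and an incidence relation between them such that: two distinct points are incident with exactly one common line; two distinct lines are incident with exactly one common point; there exist four points no three of which are collinear (points are collinear if they are incident with a common line). For distinct points $P,Q$, $PQ$ denotes the line through them; for distinct lines $\ell,m$, $\ell\cap m$ denotes their common point. Desargues-type setting. A centrally perspective pair of triangles with center $S$ consists of two triples of non-collinear points $A,B,C$ and $A',B',C'$ and a point $S$, such that $A\ne A'$, $B\neq B'$, $C\neq C'$, none of the six points equals $S$, the lines $AA'$, $BB'$, $CC'$ are pairwise distinct, and all three of them go through $S$. (Then $AB\ne A'B'$, $AC\neq A'C'$, $BC\neq B'C'$.) Put $X=AB\cap A'B'$, $Y=AC\cap A'C'$, $Z=BC\cap B'C'$. (HD) For every centrally perspective pair of triangles such that $S,X,Y$ are not collinear, $Z$ is incident with the line $XY$. (LD) For every centrally perspective pair of triangles such that $S,X,Y$ are collinear, $Z$ is incident with the line $XY$. (wLD)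 For every centrally perspective pair of triangles such that $S,X,Y$ are collinear and also $A',B,C$ are collinear, $Z$ is incident with the line $XY$. Pappus-type setting. $A,B,C$ are three distinct points of a line $\ell$, $A',B',C'$ are three distinct points of another line $\ell'\neq\ell$, $M=\ell\cap\ell'$, and none of the six points equals $M$. Put $C''=AB'\cap A'B$, $B''=AC'\cap A'C$, $A''=BC'\cap B'C$. (sPP) In the Pappus-type setting, if there is a point $S$ such that each of the triples $S,A,A'$; $S,B,B'$; $S,C,C'$ is collinear, then $M,C'',A''$ are collinear. (LP) In the Pappus-type setting, if $C'',A'',M$ are collinear, then $C'',B'',A''$ are collinear. *)

theory Defs
  imports "HOL-Analysis.Analysis"
begin

record ('p, 'l) incidence_structure =
  points :: "'p set"
  lines :: "'l set"
  inc :: "'p \<Rightarrow> 'l \<Rightarrow> bool"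

definition collinear3 :: "('p, 'l) incidence_structure \<Rightarrow> 'p \<Rightarrow> 'p \<Rightarrow> 'p \<Rightarrow> bool" where
  "collinear3 \<P> P Q R \<longleftrightarrow> (\<exists>l\<in>lines \<P>. inc \<P> P l \<and> inc \<P> Q l \<and> inc \<P> R l)"

text \<open>The explicit distinctness of the four points matters: without it, the structure with a
  single point and no lines would qualify.\<close>

locale plane_of_incidence =
  fixes \<P> :: "('p, 'l) incidence_structure"
  assumes unique_line:
      "\<lbrakk>P \<in> points \<P>; Q \<in> points \<P>; P \<noteq> Q\<rbrakk> \<Longrightarrow> \<exists>!l. l \<in> lines \<P> \<and> inc \<P> P l \<and> inc \<P> Q l"
    and unique_point:
      "\<lbrakk>l \<in> lines \<P>; m \<in> lines \<P>; l \<noteq> m\<rbrakk> \<Longrightarrow> \<exists>!P. P \<in> points \<P> \<and> inc \<P> P l \<and> inc \<P> P m"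
    and quadrangle:
      "\<exists>P\<in>points \<P>. \<exists>Q\<in>points \<P>. \<exists>R\<in>points \<P>. \<exists>T\<in>points \<P>. distinct [P, Q, R, T] \<and>
         \<not> collinear3 \<P> P Q R \<and> \<not> collinear3 \<P> P Q T \<and>
         \<not> collinear3 \<P> P R T \<and> \<not> collinear3 \<P> Q R T"

text \<open>In a plane of incidence, \<open>join\<close> is only meaningful for distinct points and \<open>meet\<close> only for
  distinct lines. Below they are applied only where the hypotheses of the configuration
  guarantee this; in particular \<open>X \<noteq> Y\<close> in the Desargues-type properties.\<close>

definition join :: "('p, 'l) incidence_structure \<Rightarrow> 'p \<Rightarrow> 'p \<Rightarrow> 'l" where
  "join \<P> P Q = (THE l. l \<in> lines \<P> \<and> inc \<P> P l \<and> inc \<P> Q l)"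

definition meet :: "('p, 'l) incidence_structure \<Rightarrow> 'l \<Rightarrow> 'l \<Rightarrow> 'p" where
  "meet \<P> l m = (THE P. P \<in> points \<P> \<and> inc \<P> P l \<and> inc \<P> P m)"


definition centrally_perspective ::
  "('p, 'l) incidence_structure \<Rightarrow> 'p \<Rightarrow> 'p \<Rightarrow> 'p \<Rightarrow> 'p \<Rightarrow> 'p \<Rightarrow> 'p \<Rightarrow> 'p \<Rightarrow> bool" where
  "centrally_perspective \<P> A B C A' B' C' S \<longleftrightarrow>
     {A, B, C, A', B', C', S} \<subseteq> points \<P> \<and>
     \<not> collinear3 \<P> A B C \<and> \<not> collinear3 \<P> A' B' C' \<and>
     A \<noteq> A' \<and> B \<noteq> B' \<and> C \<noteq> C' \<and>
     S \<notin> {A, B, C, A', B', C'} \<and>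
     join \<P> A A' \<noteq> join \<P> B B' \<and> join \<P> A A' \<noteq> join \<P> C C' \<and> join \<P> B B' \<noteq> join \<P> C C' \<and>
     inc \<P> S (join \<P> A A') \<and> inc \<P> S (join \<P> B B') \<and> inc \<P> S (join \<P> C C')"

definition HD :: "('p, 'l) incidence_structure \<Rightarrow> bool" where
  "HD \<P> \<longleftrightarrow> (\<forall>A B C A' B' C' S. centrally_perspective \<P> A B C A' B' C' S \<longrightarrow>
     (let X = meet \<P> (join \<P> A B) (join \<P> A' B');
          Y = meet \<P> (join \<P> A C) (join \<P> A' C');
          Z = meet \<P> (join \<P> B C) (join \<P> B' C')
      in \<not> collinear3 \<P> S X Y \<longrightarrow> inc \<P> Z (join \<P> X Y)))"

definition LD :: "('p, 'l) incidence_structure \<Rightarrow> bool" where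
  "LD \<P> \<longleftrightarrow> (\<forall>A B C A' B' C' S. centrally_perspective \<P> A B C A' B' C' S \<longrightarrow>
     (let X = meet \<P> (join \<P> A B) (join \<P> A' B');
          Y = meet \<P> (join \<P> A C) (join \<P> A' C');
          Z = meet \<P> (join \<P> B C) (join \<P> B' C')
      in collinear3 \<P> S X Y \<longrightarrow> inc \<P> Z (join \<P> X Y)))"

definition wLD :: "('p, 'l) incidence_structure \<Rightarrow> bool" where
  "wLD \<P> \<longleftrightarrow> (\<forall>A B C A' B' C' S. centrally_perspective \<P> A B C A' B' C' S \<longrightarrow>
     (let X = meet \<P> (join \<P> A B) (join \<P> A' B');
          Y = meet \<P> (join \<P> A C) (join \<P> A' C');
          Z = meet \<P> (join \<P> B C) (join \<P> B' C')
      in collinear3 \<P> S X Y \<and> collinear3 \<P> A' B C \<longrightarrow> inc \<P> Z (join \<P> X Y)))"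


definition pappus_setting ::
  "('p, 'l) incidence_structure \<Rightarrow> 'l \<Rightarrow> 'l \<Rightarrow> 'p \<Rightarrow> 'p \<Rightarrow> 'p \<Rightarrow> 'p \<Rightarrow> 'p \<Rightarrow> 'p \<Rightarrow> bool" where
  "pappus_setting \<P> l l' A B C A' B' C' \<longleftrightarrow>
     l \<in> lines \<P> \<and> l' \<in> lines \<P> \<and> l \<noteq> l' \<and>
     {A, B, C, A', B', C'} \<subseteq> points \<P> \<and>
     distinct [A, B, C] \<and> inc \<P> A l \<and> inc \<P> B l \<and> inc \<P> C l \<and>
     distinct [A', B', C'] \<and> inc \<P> A' l' \<and> inc \<P> B' l' \<and> inc \<P> C' l' \<and>
     meet \<P> l l' \<notin> {A, B, C, A', B', C'}"

definition sPP :: "('p, 'l) incidence_structure \<Rightarrow> bool" where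
  "sPP \<P> \<longleftrightarrow> (\<forall>l l' A B C A' B' C'. pappus_setting \<P> l l' A B C A' B' C' \<longrightarrow>
     (let M = meet \<P> l l';
          C'' = meet \<P> (join \<P> A B') (join \<P> A' B);
          A'' = meet \<P> (join \<P> B C') (join \<P> B' C)
      in (\<exists>S\<in>points \<P>. collinear3 \<P> S A A' \<and> collinear3 \<P> S B B' \<and> collinear3 \<P> S C C') \<longrightarrow>
         collinear3 \<P> M C'' A''))"

definition LP :: "('p, 'l) incidence_structure \<Rightarrow> bool" where
  "LP \<P> \<longleftrightarrow> (\<forall>l l' A B C A' B' C'. pappus_setting \<P> l l' A B C A' B' C' \<longrightarrow>
     (let M = meet \<P> l l';
          C'' = meet \<P> (join \<P> A B') (join \<P> A' B);
          B'' = meet \<P> (join \<P> A C') (join \<P> A' C);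
          A'' = meet \<P> (join \<P> B C') (join \<P> B' C)
      in collinear3 \<P> C'' A'' M \<longrightarrow> collinear3 \<P> C'' B'' A''))"


text \<open>The Euclidean plane extended by its points at infinity and its line at infinity. A point at
  infinity is a class of mutually parallel Euclidean lines, and lies on exactly the members of
  that class and on the line at infinity.\<close>

definition euclidean_lines :: "(real ^ 2) set set" where
  "euclidean_lines = {affine hull {p, q} | p q. p \<noteq> q}"

definition parallel_class :: "(real ^ 2) set \<Rightarrow> (real ^ 2) set set" where
  "parallel_class l = {m \<in> euclidean_lines. m = l \<or> m \<inter> l = {}}"

datatype ext_point = Proper "real ^ 2" | Ideal "(real ^ 2) set set"

datatype ext_line = Extended "(real ^ 2) set" | Line_at_infinity

fun ext_inc :: "ext_point \<Rightarrow> ext_line \<Rightarrow> bool" where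
  "ext_inc (Proper p) (Extended l) \<longleftrightarrow> p \<in> l"
| "ext_inc (Proper p) Line_at_infinity \<longleftrightarrow> False"
| "ext_inc (Ideal c) (Extended l) \<longleftrightarrow> l \<in> c"
| "ext_inc (Ideal c) Line_at_infinity \<longleftrightarrow> True"

definition real_projective_plane :: "(ext_point, ext_line) incidence_structure" where
  "real_projective_plane =
     \<lparr>points = range Proper \<union> Ideal ` parallel_class ` euclidean_lines,
      lines = insert Line_at_infinity (Extended ` euclidean_lines),
      inc = ext_inc\<rparr>"


text \<open>The extended Euclidean plane is indeed a plane of incidence. Lines are put into the form
  \<open>a * x + b * y = c\<close> for this purpose.\<close>

definition Ln :: "real \<Rightarrow> real \<Rightarrow> real \<Rightarrow> (real ^ 2) set" where
  "Ln a b c = {x::real^2. a * x$1 + b * x$2 = c}"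

lemma vec2_eq: "(x::real^2) = y \<longleftrightarrow> x$1 = y$1 \<and> x$2 = y$2"
  by (simp add: vec_eq_iff forall_2)

lemma hull_Ln: assumes "p \<noteq> (q::real^2)"
  shows "affine hull {p,q} = Ln (q$2 - p$2) (p$1 - q$1) ((q$2-p$2) * p$1 + (p$1-q$1) * p$2)"
proof -
  have "\<exists>u v. x = u *\<^sub>R p + v *\<^sub>R q \<and> u + v = 1" if h: "(q$2-p$2) * x$1 + (p$1-q$1) * x$2 = (q$2-p$2) * p$1 + (p$1-q$1) * p$2" for x
  proof (cases "p$1 = q$1")
    case False
    define v where "v = (x$1 - p$1)/(q$1-p$1)"
    have "v * (q$1-p$1) = x$1 - p$1" using False by (simp add: v_def)
    moreover have "(q$1-p$1) * (x$2 - p$2) = (q$1-p$1) * (v * (q$2-p$2))" using calculation h by algebra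
    hence "x$2 - p$2 = v * (q$2-p$2)" using False by simp
    ultimately show ?thesis by (intro exI[of _ "1-v"] exI[of _ v]) (simp add: vec2_eq algebra_simps)
  next
    case True
    hence n: "q$2 - p$2 \<noteq> 0" using assms by (auto simp: vec2_eq)
    define v where "v = (x$2 - p$2)/(q$2-p$2)"
    have "v * (q$2-p$2) = x$2 - p$2" using n by (simp add: v_def)
    moreover have "x$1 = p$1" using h True n by simp
    ultimately show ?thesis using True by (intro exI[of _ "1-v"] exI[of _ v]) (simp add: vec2_eq algebra_simps)
  qed
  moreover have "(q$2-p$2) * x$1 + (p$1-q$1) * x$2 = (q$2-p$2) * p$1 + (p$1-q$1) * p$2" if "x = u *\<^sub>R p + v *\<^sub>R q" "u + v = 1" for x u v
  proof -
    have "u = 1 - v" using that by simp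
    hence "x$1 = (1 - v) * p$1 + v * q$1" "x$2 = (1 - v) * p$2 + v * q$2" by (simp_all add: that(1))
    thus ?thesis by algebra
  qed
  ultimately show ?thesis unfolding affine_hull_2 Ln_def by blast
qed

lemma euclidean_lines_Ln: "euclidean_lines = {Ln a b c | a b c. a \<noteq> 0 \<or> b \<noteq> 0}"
proof (intro set_eqI iffI)
  fix l assume "l \<in> euclidean_lines"
  then obtain p q where "p \<noteq> q" "l = affine hull {p,q}" by (auto simp: euclidean_lines_def)
  moreover hence "q$2 - p$2 \<noteq> 0 \<or> p$1 - q$1 \<noteq> 0" by (auto simp: vec2_eq)
  ultimately show "l \<in> {Ln a b c | a b c. a \<noteq> 0 \<or> b \<noteq> 0}" using hull_Ln[of p q] by blast
next
  fix l assume "l \<in> {Ln a b c | a b c. a \<noteq> 0 \<or> b \<noteq> 0}"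
  then obtain a b c where l: "l = Ln a b c" and n: "a \<noteq> 0 \<or> b \<noteq> 0" by auto
  define d where "d = a*a + b*b"
  have d: "d \<noteq> 0" using n unfolding d_def by (metis sum_squares_eq_zero_iff)
  define p :: "real^2" where "p = vector [a*c/d, b*c/d]"
  define q where "q = p + vector [-b, a]"
  have pq: "p \<noteq> q" using n by (auto simp: q_def vec2_eq)
  have "a * p$1 + b * p$2 = (d * c)/d" unfolding d_def p_def by (simp add: field_simps add_divide_distrib)
  hence c: "a * p$1 + b * p$2 = c" using d by simp
  have "affine hull {p,q} = l" unfolding hull_Ln[OF pq] l using c by (simp add: q_def)
  thus "l \<in> euclidean_lines" using pq by (auto simp: euclidean_lines_def)
qed

lemma Ln_cramer: assumes "a * b' \<noteq> a' * b"
  shows "\<exists>!x. x \<in> Ln a b c \<and> x \<in> Ln a' b' c'"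
proof
  define d where "d = a * b' - a' * b"
  have d: "d \<noteq> 0" using assms by (simp add: d_def)
  define x :: "real^2" where "x = vector [(c*b' - c'*b)/d, (a*c' - a'*c)/d]"
  have "a * x$1 + b * x$2 = d * c / d" "a' * x$1 + b' * x$2 = d * c' / d"
    unfolding x_def d_def by (simp_all add: add_divide_distrib[symmetric] algebra_simps)
  thus "x \<in> Ln a b c \<and> x \<in> Ln a' b' c'" using d by (simp add: Ln_def)
  fix y assume "y \<in> Ln a b c \<and> y \<in> Ln a' b' c'"
  hence "d * y$1 = c*b' - c'*b" "d * y$2 = a*c' - a'*c" by (auto simp: Ln_def d_def algebra_simps)
  thus "y = x" using d by (auto simp: x_def vec2_eq field_simps)
qed

lemma Ln_subset: assumes "a * b' = a' * b" "a \<noteq> 0 \<or> b \<noteq> 0" "x \<in> Ln a b c" "x \<in> Ln a' b' c'" 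
  shows "Ln a b c \<subseteq> Ln a' b' c'"
proof
  fix y assume y: "y \<in> Ln a b c"
  define e where "e = a' * (y$1 - x$1) + b' * (y$2 - x$2)"
  have z: "a * (y$1 - x$1) + b * (y$2 - x$2) = 0" using y assms by (simp add: Ln_def algebra_simps)
  have "a * e = a' * (a * (y$1 - x$1) + b * (y$2 - x$2))" "b * e = b' * (a * (y$1 - x$1) + b * (y$2 - x$2))"
    unfolding e_def using assms(1) by algebra+
  hence "e = 0" using z assms(2) by auto
  thus "y \<in> Ln a' b' c'" using assms by (simp add: e_def Ln_def algebra_simps)
qed

lemma Ln_par: assumes "a \<noteq> 0 \<or> b \<noteq> 0" "a' \<noteq> 0 \<or> b' \<noteq> 0"
  shows "(Ln a' b' c' = Ln a b c \<or> Ln a' b' c' \<inter> Ln a b c = {}) \<longleftrightarrow> a * b' = a' * b"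
proof
  assume "a * b' = a' * b"
  thus "Ln a' b' c' = Ln a b c \<or> Ln a' b' c' \<inter> Ln a b c = {}"
    using Ln_subset[of a b' a' b _ c c'] Ln_subset[of a' b a b' _ c' c] assms by auto
next
  assume h: "Ln a' b' c' = Ln a b c \<or> Ln a' b' c' \<inter> Ln a b c = {}"
  show "a * b' = a' * b"
  proof (rule ccontr)
    assume n: "a * b' \<noteq> a' * b"
    then obtain x where x: "x \<in> Ln a b c" "x \<in> Ln a' b' c'" using Ln_cramer by blast
    hence e: "Ln a' b' c' = Ln a b c" using h by auto
    have "x + vector [-b, a] \<in> Ln a b c" using x by (simp add: Ln_def algebra_simps)
    moreover have "x + vector [-b, a] \<noteq> x" using assms by (auto simp: vec2_eq)
    ultimately show False using e x Ln_cramer[OF n, of c c'] by blast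
  qed
qed

lemma parallel_class_Ln: assumes "a \<noteq> 0 \<or> b \<noteq> 0"
  shows "parallel_class (Ln a b c) = {Ln a' b' c' | a' b' c'. (a' \<noteq> 0 \<or> b' \<noteq> 0) \<and> a * b' = a' * b}"
  unfolding parallel_class_def euclidean_lines_Ln using Ln_par assms by blast

lemma parallel_trans_aux: fixes a b :: real assumes "a \<noteq> 0 \<or> b \<noteq> 0" "a * b' = a' * b" "a * b'' = a'' * b" shows "a' * b'' = a'' * b'"
proof -
  have "a * (a' * b'' - a'' * b') = 0" "b * (a' * b'' - a'' * b') = 0" using assms by algebra+
  thus ?thesis using assms(1) by auto
qed

lemma Ln_mem_parallel_class: assumes "a \<noteq> 0 \<or> b \<noteq> 0" "a' \<noteq> 0 \<or> b' \<noteq> 0"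
  shows "Ln a' b' c' \<in> parallel_class (Ln a b c) \<longleftrightarrow> a * b' = a' * b"
  using Ln_par[OF assms] assms unfolding parallel_class_def euclidean_lines_Ln by blast

lemma parallel_class_eq: assumes "l \<in> euclidean_lines" "m \<in> parallel_class l"
  shows "parallel_class l = parallel_class m"
proof -
  obtain a b c where l: "l = Ln a b c" "a \<noteq> 0 \<or> b \<noteq> 0" using assms unfolding euclidean_lines_Ln by blast
  obtain a' b' c' where m: "m = Ln a' b' c'" "a' \<noteq> 0 \<or> b' \<noteq> 0" "a * b' = a' * b" using assms parallel_class_Ln l by auto
  have "a * y = x * b \<longleftrightarrow> a' * y = x * b'" for x y
    using parallel_trans_aux[of a b b' a' y x] parallel_trans_aux[of a' b' b a y x] l m by (auto simp: mult.commute)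
  thus ?thesis using parallel_class_Ln l m by auto
qed

lemma parallel_class_refl: "l \<in> euclidean_lines \<Longrightarrow> l \<in> parallel_class l" by (simp add: parallel_class_def)

lemma Ln_join: assumes "p \<noteq> q" shows "\<exists>!l. l \<in> euclidean_lines \<and> p \<in> l \<and> q \<in> l"
proof
  show H: "affine hull {p,q} \<in> euclidean_lines \<and> p \<in> affine hull {p,q} \<and> q \<in> affine hull {p,q}"
    using assms by (auto simp: euclidean_lines_def hull_inc)
  fix l assume h: "l \<in> euclidean_lines \<and> p \<in> l \<and> q \<in> l"
  then obtain a b c where l: "l = Ln a b c" "a \<noteq> 0 \<or> b \<noteq> 0" using euclidean_lines_Ln by blast
  obtain a' b' c' where m: "affine hull {p,q} = Ln a' b' c'" "a' \<noteq> 0 \<or> b' \<noteq> 0"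
    using H unfolding euclidean_lines_Ln by blast
  have pq: "p \<in> Ln a' b' c'" "q \<in> Ln a' b' c'" unfolding m(1)[symmetric] by (auto simp: hull_inc)
  have "a * b' = a' * b" using Ln_cramer[of a b' a' b c c'] h l pq assms by metis
  thus "l = affine hull {p,q}" using Ln_par[OF l(2) m(2)] h l m pq by blast
qed

lemma parallel_through: assumes "l \<in> euclidean_lines" shows "\<exists>!m. m \<in> parallel_class l \<and> p \<in> m"
proof -
  obtain a b c where l: "l = Ln a b c" "a \<noteq> 0 \<or> b \<noteq> 0" using assms unfolding euclidean_lines_Ln by blast
  have 1: "p \<in> Ln a b (a * p$1 + b * p$2)" by (simp add: Ln_def)
  have 2: "Ln a b (a * p$1 + b * p$2) \<in> parallel_class l" using l by (simp add: Ln_mem_parallel_class)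
  moreover have "m = m'" if "m \<in> parallel_class l" "p \<in> m" "m' \<in> parallel_class l" "p \<in> m'" for m m'
  proof -
    have "m' \<in> parallel_class m" using parallel_class_eq assms that by blast
    thus ?thesis using that by (auto simp: parallel_class_def)
  qed
  ultimately show ?thesis using 1 by (intro ex1I[of _ "Ln a b (a * p$1 + b * p$2)"]) auto
qed

lemma parallel_class_subset: "parallel_class l \<subseteq> euclidean_lines" by (auto simp: parallel_class_def)

lemma Ln_meet: assumes "l \<in> euclidean_lines" "m \<in> euclidean_lines" "m \<notin> parallel_class l"
  shows "\<exists>!p. p \<in> l \<and> p \<in> m"
proof -
  obtain a b c where l: "l = Ln a b c" "a \<noteq> 0 \<or> b \<noteq> 0" using assms unfolding euclidean_lines_Ln by blast
  obtain a' b' c' where m: "m = Ln a' b' c'" "a' \<noteq> 0 \<or> b' \<noteq> 0" using assms unfolding euclidean_lines_Ln by blast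
  show ?thesis using Ln_cramer[of a b' a' b c c'] l m assms Ln_mem_parallel_class[of a b a' b' c' c] by auto
qed

lemma not_collinear3_Proper: assumes "distinct [p,q,r]" "\<And>a b c. p \<in> Ln a b c \<Longrightarrow> q \<in> Ln a b c \<Longrightarrow> r \<in> Ln a b c \<Longrightarrow> a = 0 \<and> b = 0"
  shows "\<not> collinear3 real_projective_plane (Proper p) (Proper q) (Proper r)"
  using assms(2) by (auto simp: collinear3_def real_projective_plane_def euclidean_lines_Ln)

theorem plane_of_incidence_real_projective_plane:
  "plane_of_incidence real_projective_plane"
proof
  fix P Q assume P: "P \<in> points real_projective_plane" and Q: "Q \<in> points real_projective_plane" and n: "P \<noteq> Q"
  have PI: "\<exists>!l. l \<in> lines real_projective_plane \<and> ext_inc (Proper p) l \<and> ext_inc (Ideal (parallel_class k)) l"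
    if k: "k \<in> euclidean_lines" for p k
  proof -
    from parallel_through[OF k, of p] obtain m where m: "m \<in> parallel_class k" "p \<in> m"
      and u: "\<And>m'. m' \<in> parallel_class k \<Longrightarrow> p \<in> m' \<Longrightarrow> m' = m" by metis
    show ?thesis by (rule ex1I[of _ "Extended m"]) (use m parallel_class_subset in \<open>auto simp: real_projective_plane_def intro!: u del: equalityI subsetI\<close>)
  qed
  show "\<exists>!l. l \<in> lines real_projective_plane \<and> inc real_projective_plane P l \<and> inc real_projective_plane Q l"
  proof (cases P)
    case p: (Proper p)
    show ?thesis
    proof (cases Q)
      case q: (Proper q)
      from Ln_join[of p q] n p q obtain m where m: "m \<in> euclidean_lines" "p \<in> m" "q \<in> m"
        and u: "\<And>m'. m' \<in> euclidean_lines \<Longrightarrow> p \<in> m' \<Longrightarrow> q \<in> m' \<Longrightarrow> m' = m" by metis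
      show ?thesis by (rule ex1I[of _ "Extended m"]) (use m p q in \<open>auto simp: real_projective_plane_def intro!: u del: equalityI subsetI\<close>)
    next
      case q: (Ideal c)
      then obtain k where "k \<in> euclidean_lines" "c = parallel_class k" using Q by (auto simp: real_projective_plane_def)
      with PI[of k p] show ?thesis by (simp add: p q real_projective_plane_def)
    qed
  next
    case p: (Ideal c)
    then obtain k where k: "k \<in> euclidean_lines" "c = parallel_class k" using P by (auto simp: real_projective_plane_def)
    show ?thesis
    proof (cases Q)
      case q: (Proper q)
      with PI[of k q] k show ?thesis by (simp add: p q real_projective_plane_def conj_commute)
    next
      case q: (Ideal c')
      then obtain k' where k': "k' \<in> euclidean_lines" "c' = parallel_class k'" using Q by (auto simp: real_projective_plane_def)
      have "\<And>l. \<not> (l \<in> c \<and> l \<in> c')" using parallel_class_eq k k' n p q by metis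
      thus ?thesis by (intro ex1I[of _ Line_at_infinity]) (auto simp: p q real_projective_plane_def)
    qed
  qed
next
  fix l m assume l: "l \<in> lines real_projective_plane" and m: "m \<in> lines real_projective_plane" and n: "l \<noteq> m"
  have PI: "\<exists>!P. P \<in> points real_projective_plane \<and> ext_inc P (Extended k) \<and> ext_inc P Line_at_infinity"
    if k: "k \<in> euclidean_lines" for k
    apply (rule ex1I[of _ "Ideal (parallel_class k)"])
    using k parallel_class_refl by (auto simp: real_projective_plane_def intro!: parallel_class_eq)
  show "\<exists>!P. P \<in> points real_projective_plane \<and> inc real_projective_plane P l \<and> inc real_projective_plane P m"
  proof (cases l)
    case a: (Extended k)
    have k: "k \<in> euclidean_lines" using a l by (auto simp: real_projective_plane_def)
    show ?thesis
    proof (cases m)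
      case b: (Extended k')
      have k': "k' \<in> euclidean_lines" using b m by (auto simp: real_projective_plane_def)
      show ?thesis
      proof (cases "k' \<in> parallel_class k")
        case True
        hence d: "k \<inter> k' = {}" using n a b by (auto simp: parallel_class_def)
        show ?thesis apply (rule ex1I[of _ "Ideal (parallel_class k)"])
          using k k' True d parallel_class_refl by (auto simp: real_projective_plane_def a b intro!: parallel_class_eq)
      next
        case False
        from Ln_meet[OF k k' False] obtain p where p: "p \<in> k" "p \<in> k'" "\<And>q. q \<in> k \<Longrightarrow> q \<in> k' \<Longrightarrow> q = p" by metis
        show ?thesis apply (rule ex1I[of _ "Proper p"])
          using k k' False p(1,2) by (auto simp: real_projective_plane_def a b intro!: p(3) dest: parallel_class_eq)
      qed
    next
      case Line_at_infinity
      with PI[OF k] show ?thesis by (simp add: a real_projective_plane_def)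
    qed
  next
    case a: Line_at_infinity
    then obtain k where "m = Extended k" "k \<in> euclidean_lines" using m n by (auto simp: real_projective_plane_def)
    with PI[of k] show ?thesis by (simp add: a real_projective_plane_def conj_commute)
  qed
next
  let ?v = "\<lambda>x y. vector [x, y] :: real^2"
  let ?P = "Proper (?v 0 0)" and ?Q = "Proper (?v 1 0)" and ?R = "Proper (?v 0 1)" and ?T = "Proper (?v 1 1)"
  have d: "distinct [?P,?Q,?R,?T]" by (simp add: vec2_eq)
  have "\<not> collinear3 real_projective_plane ?P ?Q ?R" "\<not> collinear3 real_projective_plane ?P ?Q ?T"
   "\<not> collinear3 real_projective_plane ?P ?R ?T" "\<not> collinear3 real_projective_plane ?Q ?R ?T"
    by (rule not_collinear3_Proper; use d in \<open>auto simp: Ln_def\<close>)+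
  thus "\<exists>P\<in>points real_projective_plane. \<exists>Q\<in>points real_projective_plane. \<exists>R\<in>points real_projective_plane. \<exists>T\<in>points real_projective_plane. distinct [P, Q, R, T] \<and>
         \<not> collinear3 real_projective_plane P Q R \<and> \<not> collinear3 real_projective_plane P Q T \<and>
         \<not> collinear3 real_projective_plane P R T \<and> \<not> collinear3 real_projective_plane Q R T"
    using d by (intro bexI[of _ ?P] bexI[of _ ?Q] bexI[of _ ?R] bexI[of _ ?T] conjI) (auto simp: real_projective_plane_def)
qed
end

theory Submission imports Defs begin

text \<open>
  The first three claims come from relabelling one configuration, the fourth from coordinates.

  \<^item> From (HD) to (LD): the three side intersections \<open>X, Y, Z\<close> play symmetric roles. If \<open>S, X, Z\<close>
    are collinear, then \<open>Z\<close> lies on \<open>SX\<close>, which is \<open>XY\<close>. If they are not, then (HD), applied to the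
    same triangles with the first two vertices exchanged, puts \<open>Y\<close> on \<open>XZ\<close>
    (\<open>HD_imp_LD\<close>).

  \<^item> (wLD) and (sPP) are the same statement about ten points. Both say that the fourth harmonic
    point of three points on a line is independent of part of the quadrangle constructing it.
    Given a perspective pair as in (wLD), the axis carries \<open>X, S, Y\<close> and the line \<open>BC\<close>
    carries \<open>B, A', C\<close>. These two triples are perspective from \<open>A\<close>, and the cross
    joins of (sPP) meet in \<open>B'\<close> and \<open>C'\<close> (\<open>sPP_imp_wLD\<close>). Reading the same dictionary backwards,
    the Pappus figure of (sPP) contains the triangles \<open>S A' C'\<close> and \<open>B' C'' A''\<close>, which are
    perspective from \<open>B\<close> (\<open>wLD_imp_sPP\<close>).

  \<^item> (LP) follows from (sPP) through a converse of (sPP): if \<open>M, C'', A''\<close> are collinear, then \<open>CC'\<close>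
    passes through \<open>S = AA' \<inter> BB'\<close>. For let \<open>D\<close> be the projection of \<open>C\<close> from \<open>S\<close> to the second line. By
    (sPP), \<open>BD\<close> and \<open>B'C\<close> meet on \<open>MC''\<close>, hence in \<open>A''\<close>, hence \<open>D = C'\<close>. Now
    the three triples are in perspective, and (sPP) applied with the first two indices exchanged
    puts \<open>B''\<close> on the same line \<open>MC''\<close> (\<open>sPP_imp_LP\<close>).

  \<^item> The extended Euclidean plane has homogeneous coordinates in \<open>\<real>\<^sup>3\<close>, and there Desargues' theorem
    is one line of linear algebra: if \<open>s = \<alpha> a + \<alpha>' a' = \<beta> b + \<beta>' b' = \<gamma> c + \<gamma>' c'\<close>, then \<open>\<alpha> a - \<beta> b\<close>,
    \<open>\<alpha> a - \<gamma> c\<close> and \<open>\<beta> b - \<gamma> c\<close> represent \<open>X\<close>, \<open>Y\<close> and \<open>Z\<close>, and the third is a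
    difference of the other two. This contains (LD) for the real projective plane
    (\<open>desargues\<close>).
\<close>

section \<open>Lines and points in a plane of incidence\<close>

lemma join_commute: "join \<P> P Q = join \<P> Q P"
  by (simp add: join_def conj_commute)

lemma collinear3_perms:
  "collinear3 \<P> P R Q \<longleftrightarrow> collinear3 \<P> P Q R"
  "collinear3 \<P> Q P R \<longleftrightarrow> collinear3 \<P> P Q R"
  "collinear3 \<P> Q R P \<longleftrightarrow> collinear3 \<P> P Q R"
  by (auto simp: collinear3_def)

context plane_of_incidence
begin

lemma line_unique:
  assumes "P \<in> points \<P>" "Q \<in> points \<P>" "P \<noteq> Q" "l \<in> lines \<P>" "m \<in> lines \<P>"
    and "inc \<P> P l" "inc \<P> Q l" "inc \<P> P m" "inc \<P> Q m"
  shows "l = m"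
  using assms unique_line[of P Q] by blast

lemma join_line:
  assumes "P \<in> points \<P>" "Q \<in> points \<P>" "P \<noteq> Q"
  shows "join \<P> P Q \<in> lines \<P>" "inc \<P> P (join \<P> P Q)" "inc \<P> Q (join \<P> P Q)"
  using theI'[OF unique_line[OF assms]] by (auto simp: join_def)

lemma join_eqI:
  assumes "P \<in> points \<P>" "Q \<in> points \<P>" "P \<noteq> Q" "l \<in> lines \<P>" "inc \<P> P l" "inc \<P> Q l"
  shows "join \<P> P Q = l"
  using line_unique[OF assms(1-3) join_line(1)[OF assms(1-3)] assms(4)] assms join_line by blast

lemma meet_point:
  assumes "l \<in> lines \<P>" "m \<in> lines \<P>" "l \<noteq> m"
  shows "meet \<P> l m \<in> points \<P>" "inc \<P> (meet \<P> l m) l" "inc \<P> (meet \<P> l m) m"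
  using theI'[OF unique_point[OF assms]] by (auto simp: meet_def)

lemma meet_eqI:
  assumes "l \<in> lines \<P>" "m \<in> lines \<P>" "l \<noteq> m" "P \<in> points \<P>" "inc \<P> P l" "inc \<P> P m"
  shows "meet \<P> l m = P"
  using unique_point[OF assms(1-3)] meet_point[OF assms(1-3)] assms by blast

lemma collinear3_iff_inc_join:
  assumes "P \<in> points \<P>" "Q \<in> points \<P>" "P \<noteq> Q"
  shows "collinear3 \<P> P Q R \<longleftrightarrow> inc \<P> R (join \<P> P Q)"
  using assms join_line[OF assms] join_eqI[OF assms] unfolding collinear3_def by blast

section \<open>Perspective triangles\<close>

text \<open>The facts about sides are proved for the vertices \<open>A, B\<close> only; these symmetries carry it over to the
  other sides and to the second triangle.\<close>

lemma perspective_permute: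
  assumes "centrally_perspective \<P> A B C A' B' C' S"
  shows "centrally_perspective \<P> A C B A' C' B' S" "centrally_perspective \<P> B A C B' A' C' S"
    "centrally_perspective \<P> B C A B' C' A' S"
    "centrally_perspective \<P> A' B' C' A B C S"
  using assms unfolding centrally_perspective_def
  by (auto simp: collinear3_perms join_commute)

lemma perspective_points:
  assumes "centrally_perspective \<P> A B C A' B' C' S"
  shows "{A,B,C,A',B',C',S} \<subseteq> points \<P>"
  using assms by (simp add: centrally_perspective_def)

lemma perspective_not_collinear:
  assumes "centrally_perspective \<P> A B C A' B' C' S"
  shows "\<not> collinear3 \<P> A B C"
  using assms by (simp add: centrally_perspective_def)

text \<open>Not immediate from the definition, because \<open>collinear3\<close> asks for a line: if \<open>P = Q = R\<close>, a
  second point is needed to have any line through it.\<close>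

lemma noncollinear_distinct:
  assumes "P \<in> points \<P>" "Q \<in> points \<P>" "R \<in> points \<P>" "\<not> collinear3 \<P> P Q R"
  shows "P \<noteq> Q"
proof
  assume "P = Q"
  obtain T where "T \<in> points \<P>" "T \<noteq> R" using quadrangle by (metis distinct_length_2_or_more)
  then show False using assms \<open>P = Q\<close> join_line[of P R] join_line[of T R]
    unfolding collinear3_def by metis
qed

text \<open>A side \<open>AB\<close> through \<open>A'\<close> or \<open>B'\<close> would be the ray \<open>AA'\<close> or \<open>BB'\<close> and thus pass through \<open>S\<close>.
  Passing through \<open>S\<close>, it would be both rays at once, and these differ.\<close>

lemma perspective_side:
  assumes cp: "centrally_perspective \<P> A B C A' B' C' S"
  shows "A \<noteq> B" "\<not> inc \<P> S (join \<P> A B)" "\<not> inc \<P> A' (join \<P> A B)" "\<not> inc \<P> B' (join \<P> A B)"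
proof -
  have pts: "A \<in> points \<P>" "B \<in> points \<P>" "C \<in> points \<P>" "A' \<in> points \<P>" "B' \<in> points \<P>"
    "S \<in> points \<P>" using perspective_points[OF cp] by auto
  show AB: "A \<noteq> B" using noncollinear_distinct perspective_not_collinear[OF cp] pts by blast
  have d: "A \<noteq> A'" "B \<noteq> B'" "S \<noteq> A" "S \<noteq> B" "join \<P> A A' \<noteq> join \<P> B B'"
     and S: "inc \<P> S (join \<P> A A')" "inc \<P> S (join \<P> B B')"
    using cp by (auto simp: centrally_perspective_def)
  note j = join_line[OF pts(1,2) AB] join_line[OF pts(1,4) d(1)] join_line[OF pts(2,5) d(2)]
  show off: "\<not> inc \<P> S (join \<P> A B)"
    using line_unique[OF pts(6,1) d(3), of "join \<P> A B" "join \<P> A A'"]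
          line_unique[OF pts(6,2) d(4), of "join \<P> A B" "join \<P> B B'"] d S j by metis
  show "\<not> inc \<P> A' (join \<P> A B)"
    using off join_eqI[OF pts(1,4) d(1) j(1) j(2)] S by metis
  show "\<not> inc \<P> B' (join \<P> A B)"
    using off join_eqI[OF pts(2,5) d(2) j(1) j(3)] S by metis
qed

lemma perspective_axis_point:
  assumes cp: "centrally_perspective \<P> A B C A' B' C' S"
    and X: "X = meet \<P> (join \<P> A B) (join \<P> A' B')"
  shows "join \<P> A B \<noteq> join \<P> A' B'" "X \<in> points \<P>" "inc \<P> X (join \<P> A B)" "inc \<P> X (join \<P> A' B')"
     "X \<noteq> S" "X \<noteq> A" "X \<noteq> B" "X \<noteq> A'" "X \<noteq> B'"
proof -
  note cp' = perspective_permute(4)[OF cp]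
  note s = perspective_side[OF cp] and s' = perspective_side[OF cp']
  have pts: "A \<in> points \<P>" "B \<in> points \<P>" "A' \<in> points \<P>" "B' \<in> points \<P>"
    using perspective_points[OF cp] by auto
  note j = join_line[OF pts(1,2) s(1)] join_line[OF pts(3,4) s'(1)]
  show ne: "join \<P> A B \<noteq> join \<P> A' B'" using j s by metis
  show X': "X \<in> points \<P>" "inc \<P> X (join \<P> A B)" "inc \<P> X (join \<P> A' B')"
    using meet_point[OF j(1,4) ne] X by auto
  show "X \<noteq> S" "X \<noteq> A" "X \<noteq> B" "X \<noteq> A'" "X \<noteq> B'" using s s' X' by auto
qed

text \<open>A common value of \<open>X\<close> and \<open>Y\<close> would lie on \<open>AB\<close> and \<open>AC\<close>, hence be \<open>A\<close>; but \<open>A\<close> is not on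
  \<open>A'B'\<close>. So the line \<open>XY\<close> in the Desargues properties is always a genuine join.\<close>

lemma perspective_axis_points_distinct:
  assumes cp: "centrally_perspective \<P> A B C A' B' C' S"
  shows "meet \<P> (join \<P> A B) (join \<P> A' B') \<noteq> meet \<P> (join \<P> A C) (join \<P> A' C')" (is "?X \<noteq> ?Y")
proof
  assume eq: "?X = ?Y"
  note cp' = perspective_permute(1)[OF cp]
  note x = perspective_axis_point[OF cp refl] and y = perspective_axis_point[OF cp' refl]
  have pts: "A \<in> points \<P>" "B \<in> points \<P>" "C \<in> points \<P>"
    using perspective_points[OF cp] by auto
  note j = join_line[OF pts(1,2) perspective_side(1)[OF cp]]
    and k = join_line[OF pts(1,3) perspective_side(1)[OF cp']]
  have "join \<P> A B = join \<P> A C"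
    using line_unique[OF x(2) pts(1) x(6) j(1) k(1)] j k x y eq by metis
  then show False using j k perspective_not_collinear[OF cp] unfolding collinear3_def by metis
qed

text \<open>Exchanging \<open>A\<close> with \<open>B\<close> fixes \<open>X\<close> and exchanges \<open>Y\<close> with \<open>Z\<close>. If \<open>Z\<close> were off
  \<open>XY\<close>, the line through \<open>S, X, Y\<close>, then \<open>S, X, Z\<close> would not be collinear, and (HD) for the
  exchanged triangles would put \<open>Y\<close> on \<open>XZ\<close>.\<close>

lemma HD_imp_LD:
  assumes "HD \<P>"
  shows "LD \<P>"
  unfolding LD_def Let_def
proof (intro allI impI)
  fix A B C A' B' C' S
  assume cp: "centrally_perspective \<P> A B C A' B' C' S"
  define X where "X = meet \<P> (join \<P> A B) (join \<P> A' B')"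
  define Y where "Y = meet \<P> (join \<P> A C) (join \<P> A' C')"
  define Z where "Z = meet \<P> (join \<P> B C) (join \<P> B' C')"
  note cp' = perspective_permute(2)[OF cp]
  assume "collinear3 \<P> S (meet \<P> (join \<P> A B) (join \<P> A' B')) (meet \<P> (join \<P> A C) (join \<P> A' C'))"
  then have SXY: "collinear3 \<P> S X Y" unfolding X_def Y_def .
  have S: "S \<in> points \<P>" using perspective_points[OF cp] by simp
  have X: "X \<in> points \<P>" "X \<noteq> S" using perspective_axis_point[OF cp X_def] by auto
  have Y: "Y \<in> points \<P>" using perspective_axis_point[OF perspective_permute(1)[OF cp] Y_def] by auto
  have Z: "Z \<in> points \<P>" using perspective_axis_point[OF perspective_permute(3)[OF cp] Z_def] by auto
  have XY: "X \<noteq> Y" using perspective_axis_points_distinct[OF cp] X_def Y_def by simp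
  have XZ: "X \<noteq> Z" using perspective_axis_points_distinct[OF cp'] X_def Z_def by (simp add: join_commute)
  have "inc \<P> Z (join \<P> X Y)"
  proof (cases "collinear3 \<P> S X Z")
    case True
    then have "inc \<P> Y (join \<P> S X)" "inc \<P> Z (join \<P> S X)"
      using SXY collinear3_iff_inc_join[OF S X(1) X(2)[symmetric]] by auto
    then show ?thesis
      using join_eqI[OF X(1) Y XY] join_line[OF S X(1) X(2)[symmetric]] by simp
  next
    case False
    then have "inc \<P> Y (join \<P> X Z)"
      using assms[unfolded HD_def Let_def, rule_format, OF cp'] X_def Y_def Z_def by (simp add: join_commute)
    then show ?thesis using collinear3_iff_inc_join X(1) Y Z XY XZ collinear3_perms(1) by metis
  qed
  then show "inc \<P> (meet \<P> (join \<P> B C) (join \<P> B' C'))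
     (join \<P> (meet \<P> (join \<P> A B) (join \<P> A' B')) (meet \<P> (join \<P> A C) (join \<P> A' C')))"
    unfolding X_def Y_def Z_def .
qed

section \<open>The Pappus configuration\<close>

lemma pappus_lines_meet:
  assumes "pappus_setting \<P> l l' A B C A' B' C'"
  shows "meet \<P> l l' \<in> points \<P>" "inc \<P> (meet \<P> l l') l" "inc \<P> (meet \<P> l l') l'"
  using assms meet_point[of l l'] unfolding pappus_setting_def by auto

lemma pappus_points_off:
  assumes ps: "pappus_setting \<P> l l' A B C A' B' C'"
  shows "\<not> inc \<P> A l'" "\<not> inc \<P> B l'" "\<not> inc \<P> C l'" "\<not> inc \<P> A' l" "\<not> inc \<P> B' l" "\<not> inc \<P> C' l"
proof -
  have l: "l \<in> lines \<P>" "l' \<in> lines \<P>" "l \<noteq> l'" using ps by (auto simp: pappus_setting_def)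
  have "\<not> (inc \<P> P l \<and> inc \<P> P l')" if "P \<in> {A, B, C, A', B', C'}" for P
    using that ps meet_eqI[OF l, of P] unfolding pappus_setting_def by blast
  then show "\<not> inc \<P> A l'" "\<not> inc \<P> B l'" "\<not> inc \<P> C l'" "\<not> inc \<P> A' l" "\<not> inc \<P> B' l" "\<not> inc \<P> C' l"
    using ps by (auto simp: pappus_setting_def)
qed

lemma pappus_swap:
  assumes "pappus_setting \<P> l l' A B C A' B' C'"
  shows "pappus_setting \<P> l l' B A C B' A' C'"
  using assms unfolding pappus_setting_def by auto

lemma transversal_meets_line_once:
  assumes "l \<in> lines \<P>" "m \<in> lines \<P>" "A \<in> points \<P>" "X \<in> points \<P>"
    and "inc \<P> A l" "inc \<P> X l" "inc \<P> A m" "inc \<P> X m" "inc \<P> P m" "\<not> inc \<P> P l"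
  shows "X = A"
  using line_unique[OF assms(3,4) _ assms(1,2)] assms by blast

text \<open>This supplies the cross points \<open>C''\<close> and \<open>A''\<close> of a Pappus figure, and the cross point that
  takes the place of \<open>A''\<close> when \<open>C'\<close> is replaced by an auxiliary point.\<close>

lemma cross_joins:
  assumes l: "l \<in> lines \<P>" "l' \<in> lines \<P>"
    and pts: "A \<in> points \<P>" "B \<in> points \<P>" "A' \<in> points \<P>" "B' \<in> points \<P>" and d: "A \<noteq> B" "A' \<noteq> B'"
    and on: "inc \<P> A l" "inc \<P> B l" "inc \<P> A' l'" "inc \<P> B' l'"
    and off: "\<not> inc \<P> A l'" "\<not> inc \<P> B l'" "\<not> inc \<P> A' l" "\<not> inc \<P> B' l"
    and X: "X = meet \<P> (join \<P> A B') (join \<P> A' B)"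
  shows "join \<P> A B' \<noteq> join \<P> A' B" "X \<in> points \<P>" "inc \<P> X (join \<P> A B')" "inc \<P> X (join \<P> A' B)"
    "\<not> inc \<P> X l" "\<not> inc \<P> X l'"
proof -
  have ne: "A \<noteq> B'" "A' \<noteq> B" using on off by auto
  note j = join_line[OF pts(1,4) ne(1)] join_line[OF pts(3,2) ne(2)]
  show *: "join \<P> A B' \<noteq> join \<P> A' B" using line_unique[OF pts(1,2) d(1) l(1) j(1)] j on off by metis
  show X': "X \<in> points \<P>" "inc \<P> X (join \<P> A B')" "inc \<P> X (join \<P> A' B)"
    using meet_point[OF j(1,4) *] X by auto
  show "\<not> inc \<P> X l"
    using transversal_meets_line_once[OF l(1) j(1) pts(1) X'(1) on(1) _ j(2) X'(2) j(3) off(4)]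
      transversal_meets_line_once[OF l(1) j(4) pts(2) X'(1) on(2) _ j(6) X'(3) j(5) off(3)] d by auto
  show "\<not> inc \<P> X l'"
    using transversal_meets_line_once[OF l(2) j(1) pts(4) X'(1) on(4) _ j(3) X'(2) j(2) off(1)]
      transversal_meets_line_once[OF l(2) j(4) pts(3) X'(1) on(3) _ j(5) X'(3) j(6) off(2)] d by auto
qed

section \<open>Weak Little-Desargues and strong perspective Pappus\<close>

text \<open>The dictionary: the first Pappus line is the axis \<open>XY\<close> with the points \<open>X, S, Y\<close>, the second is
  \<open>BC\<close> with the points \<open>B, A', C\<close>, and \<open>A\<close> is the centre, since \<open>X \<in> AB\<close>, \<open>A' \<in> AS\<close> and
  \<open>Y \<in> AC\<close>. Then \<open>XA' \<inter> BS = B'\<close> and \<open>SC \<inter> A'Y = C'\<close>, so (sPP) says that the intersection of the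
  axis with \<open>BC\<close> lies on \<open>B'C'\<close>, that is, it equals \<open>Z\<close>.\<close>

lemma sPP_imp_wLD:
  assumes sPP: "sPP \<P>"
  shows "wLD \<P>"
  unfolding wLD_def Let_def
proof (intro allI impI)
  fix A B C A' B' C' S
  assume cp: "centrally_perspective \<P> A B C A' B' C' S"
  define X where "X = meet \<P> (join \<P> A B) (join \<P> A' B')"
  define Y where "Y = meet \<P> (join \<P> A C) (join \<P> A' C')"
  define Z where "Z = meet \<P> (join \<P> B C) (join \<P> B' C')"
  assume "collinear3 \<P> S (meet \<P> (join \<P> A B) (join \<P> A' B')) (meet \<P> (join \<P> A C) (join \<P> A' C'))
    \<and> collinear3 \<P> A' B C"
  then have col: "collinear3 \<P> S X Y" "collinear3 \<P> A' B C" unfolding X_def Y_def by auto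
  note cpC = perspective_permute(1)[OF cp] and cpBC = perspective_permute(3)[OF cp] and cp' = perspective_permute(4)[OF cp]
  note cpC' = perspective_permute(1)[OF cp'] and cpBC' = perspective_permute(3)[OF cp']
  have pts: "A \<in> points \<P>" "B \<in> points \<P>" "C \<in> points \<P>" "A' \<in> points \<P>" "B' \<in> points \<P>"
    "C' \<in> points \<P>" "S \<in> points \<P>" using perspective_points[OF cp] by auto
  note x = perspective_axis_point[OF cp X_def] and y = perspective_axis_point[OF cpC Y_def]
    and z = perspective_axis_point[OF cpBC Z_def]
  have XY: "X \<noteq> Y" using perspective_axis_points_distinct[OF cp] X_def Y_def by simp
  note ab = join_line[OF pts(1,2) perspective_side(1)[OF cp]]
    and ac = join_line[OF pts(1,3) perspective_side(1)[OF cpC]]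
    and bc = join_line[OF pts(2,3) perspective_side(1)[OF cpBC]]
    and a'b' = join_line[OF pts(4,5) perspective_side(1)[OF cp']]
    and a'c' = join_line[OF pts(4,6) perspective_side(1)[OF cpC']]
    and b'c' = join_line[OF pts(5,6) perspective_side(1)[OF cpBC']]
    and L = join_line[OF x(2) y(2) XY]
  have SL: "inc \<P> S (join \<P> X Y)"
    using col(1) collinear3_iff_inc_join[OF x(2) y(2) XY] by (simp add: collinear3_perms)
  have A': "inc \<P> A' (join \<P> B C)"
    using col(2) collinear3_iff_inc_join[OF pts(2,3) perspective_side(1)[OF cpBC]] by (simp add: collinear3_perms)
  have A'B: "A' \<noteq> B" "A' \<noteq> C" using perspective_side[OF cp] ab perspective_side[OF cpC] ac by auto
  have Soff: "\<not> inc \<P> S (join \<P> B C)" using perspective_side[OF cpBC] by auto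
  have ABC: "join \<P> A B \<noteq> join \<P> B C" "join \<P> A C \<noteq> join \<P> B C"
    using perspective_not_collinear[OF cp] ab ac bc unfolding collinear3_def by metis+
  have Xoff: "\<not> inc \<P> X (join \<P> B C)"
    using line_unique[OF x(2) pts(2) x(7) ab(1) bc(1)] x ab bc ABC by auto
  have Yoff: "\<not> inc \<P> Y (join \<P> B C)"
    using line_unique[OF y(2) pts(3) y(7) ac(1) bc(1)] y ac bc ABC by auto
  have BL: "\<not> inc \<P> B (join \<P> X Y)"
    using line_unique[OF x(2) pts(2) x(7) ab(1) L(1)] x ab L SL perspective_side[OF cp] by auto
  have CL: "\<not> inc \<P> C (join \<P> X Y)"
    using line_unique[OF y(2) pts(3) y(7) ac(1) L(1)] y ac L SL perspective_side[OF cpC] by auto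
  have A'L: "\<not> inc \<P> A' (join \<P> X Y)"
    using line_unique[OF x(2) pts(4) x(8) a'b'(1) L(1)] x a'b' L SL perspective_side[OF cp'] by auto
  define M where "M = meet \<P> (join \<P> X Y) (join \<P> B C)"
  have Lbc: "join \<P> X Y \<noteq> join \<P> B C" using SL Soff by auto
  have M: "M \<in> points \<P>" "inc \<P> M (join \<P> X Y)" "inc \<P> M (join \<P> B C)"
    using meet_point[OF L(1) bc(1) Lbc] M_def by auto
  have ps: "pappus_setting \<P> (join \<P> X Y) (join \<P> B C) X S Y B A' C"
    unfolding pappus_setting_def M_def[symmetric]
    using L bc Lbc x y pts SL A' A'B XY perspective_side(1)[OF cpBC] M BL CL A'L Xoff Yoff Soff by auto
  have d: "A \<noteq> A'" "B \<noteq> B'" "C \<noteq> C'" "S \<noteq> A" "S \<noteq> B" "S \<noteq> C" "join \<P> B B' \<noteq> join \<P> C C'"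
     and sS: "inc \<P> S (join \<P> A A')" "inc \<P> S (join \<P> B B')" "inc \<P> S (join \<P> C C')"
    using cp by (auto simp: centrally_perspective_def)
  note aa' = join_line[OF pts(1,4) d(1)] and bb' = join_line[OF pts(2,5) d(2)] and cc' = join_line[OF pts(3,6) d(3)]
  have e: "join \<P> X A' = join \<P> A' B'" "join \<P> B S = join \<P> B B'"
    "join \<P> S C = join \<P> C C'" "join \<P> A' Y = join \<P> A' C'"
    using join_eqI[OF x(2) pts(4) x(8) a'b'(1)] join_eqI[OF pts(2,7) d(5)[symmetric] bb'(1)]
      join_eqI[OF pts(7,3) d(6) cc'(1)] join_eqI[OF pts(4) y(2) y(8)[symmetric] a'c'(1)]
      x y a'b' a'c' bb' cc' sS by auto
  \<comment> \<open>The two cross points of the Pappus figure, and its centre \<open>A\<close>.\<close>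
  have "meet \<P> (join \<P> X A') (join \<P> B S) = B'"
    unfolding e by (rule meet_eqI) (use a'b' bb' pts sS perspective_side[OF cp'] in auto)
  moreover have "meet \<P> (join \<P> S C) (join \<P> A' Y) = C'"
    unfolding e by (rule meet_eqI) (use a'c' cc' pts sS perspective_side[OF cpC'] in auto)
  moreover have "\<exists>S'\<in>points \<P>. collinear3 \<P> S' X B \<and> collinear3 \<P> S' S A' \<and> collinear3 \<P> S' Y C"
    using pts ab ac aa' sS x y unfolding collinear3_def by blast
  ultimately have "collinear3 \<P> M B' C'"
    using sPP[unfolded sPP_def Let_def, rule_format, OF ps] M_def by simp
  then have "inc \<P> M (join \<P> B' C')"
    using collinear3_iff_inc_join[OF pts(5,6) perspective_side(1)[OF cpBC']] by (simp add: collinear3_perms)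
  then have "Z = M" using meet_eqI[OF bc(1) b'c'(1) z(1) M(1)] M Z_def by simp
  then show "inc \<P> (meet \<P> (join \<P> B C) (join \<P> B' C'))
     (join \<P> (meet \<P> (join \<P> A B) (join \<P> A' B')) (meet \<P> (join \<P> A C) (join \<P> A' C')))"
    using M unfolding X_def Y_def Z_def by simp
qed

text \<open>The same dictionary read backwards: the triangles \<open>S A' C'\<close> and \<open>B' C'' A''\<close> are in
  perspective from \<open>B\<close>, and their sides through \<open>S\<close> and \<open>B'\<close> meet in \<open>A\<close> and \<open>C\<close>, which are
  collinear with \<open>B\<close>. The vertex \<open>B'\<close> lies on the opposite side \<open>A'C'\<close>, so (wLD) applies, and
  the third pair of sides \<open>A'C'\<close>, \<open>C''A''\<close> meets on \<open>AC\<close>, that is, in \<open>M\<close>.\<close>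

lemma wLD_imp_sPP:
  assumes wLD: "wLD \<P>"
  shows "sPP \<P>"
  unfolding sPP_def Let_def
proof (intro allI impI)
  fix l l' A B C A' B' C'
  assume ps: "pappus_setting \<P> l l' A B C A' B' C'"
  define M where "M = meet \<P> l l'"
  define C'' where "C'' = meet \<P> (join \<P> A B') (join \<P> A' B)"
  define A'' where "A'' = meet \<P> (join \<P> B C') (join \<P> B' C)"
  assume "\<exists>S\<in>points \<P>. collinear3 \<P> S A A' \<and> collinear3 \<P> S B B' \<and> collinear3 \<P> S C C'"
  then obtain S where S: "S \<in> points \<P>" "collinear3 \<P> S A A'" "collinear3 \<P> S B B'" "collinear3 \<P> S C C'"
    by blast
  have l: "l \<in> lines \<P>" "l' \<in> lines \<P>" "l \<noteq> l'"
    and pts: "A \<in> points \<P>" "B \<in> points \<P>" "C \<in> points \<P>" "A' \<in> points \<P>" "B' \<in> points \<P>" "C' \<in> points \<P>"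
    and d: "A \<noteq> B" "A \<noteq> C" "B \<noteq> C" "A' \<noteq> B'" "A' \<noteq> C'" "B' \<noteq> C'"
    and on: "inc \<P> A l" "inc \<P> B l" "inc \<P> C l" "inc \<P> A' l'" "inc \<P> B' l'" "inc \<P> C' l'"
    using ps by (auto simp: pappus_setting_def)
  note off = pappus_points_off[OF ps]
  have n: "A \<noteq> A'" "A \<noteq> B'" "A' \<noteq> B" "B \<noteq> B'" "B \<noteq> C'" "B' \<noteq> C" "C \<noteq> C'" using on off by auto
  note aa' = join_line[OF pts(1,4) n(1)] and ab' = join_line[OF pts(1,5) n(2)]
    and a'b = join_line[OF pts(4,2) n(3)] and bb' = join_line[OF pts(2,5) n(4)]
    and bc' = join_line[OF pts(2,6) n(5)] and b'c = join_line[OF pts(5,3) n(6)]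
    and cc' = join_line[OF pts(3,6) n(7)]
  note c'' = cross_joins[OF l(1,2) pts(1,2,4,5) d(1,4) on(1,2,4,5) off(1,2,4,5) C''_def]
  note a'' = cross_joins[OF l(1,2) pts(2,3,5,6) d(3,6) on(2,3,5,6) off(2,3,5,6) A''_def]
  have sS: "inc \<P> S (join \<P> A A')" "inc \<P> S (join \<P> B B')" "inc \<P> S (join \<P> C C')"
    using S collinear3_iff_inc_join pts n by (metis collinear3_perms)+
  have Sl: "\<not> inc \<P> S l"
    using transversal_meets_line_once[OF l(1) aa'(1) pts(1) S(1) on(1) _ aa'(2) sS(1) aa'(3) off(4)]
      transversal_meets_line_once[OF l(1) bb'(1) pts(2) S(1) on(2) _ bb'(2) sS(2) bb'(3) off(5)] d by auto
  have Sl': "\<not> inc \<P> S l'"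
    using transversal_meets_line_once[OF l(2) aa'(1) pts(4) S(1) on(4) _ aa'(3) sS(1) aa'(2) off(1)]
      transversal_meets_line_once[OF l(2) bb'(1) pts(5) S(1) on(5) _ bb'(3) sS(2) bb'(2) off(2)] d by auto
  have ne: "S \<noteq> A'" "S \<noteq> B'" "S \<noteq> C'" "A' \<noteq> C''" "C' \<noteq> A''" "B' \<noteq> C''" "B' \<noteq> A''" "B \<noteq> S" "B \<noteq> C''" "B \<noteq> A''"
    using Sl Sl' on c'' a'' by auto
  have e: "join \<P> S B' = join \<P> B B'" "join \<P> A' C'' = join \<P> A' B" "join \<P> C' A'' = join \<P> B C'"
    "join \<P> S A' = join \<P> A A'" "join \<P> S C' = join \<P> C C'" "join \<P> B' C'' = join \<P> A B'" "join \<P> B' A'' = join \<P> B' C"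
    "join \<P> A' C' = l'" "join \<P> A C = l"
    using join_eqI[OF S(1) pts(5) ne(2) bb'(1)] join_eqI[OF pts(4) c''(2) ne(4) a'b(1)] join_eqI[OF pts(6) a''(2) ne(5) bc'(1)]
      join_eqI[OF S(1) pts(4) ne(1) aa'(1)] join_eqI[OF S(1) pts(6) ne(3) cc'(1)]
      join_eqI[OF pts(5) c''(2) ne(6) ab'(1)] join_eqI[OF pts(5) a''(2) ne(7) b'c(1)]
      join_eqI[OF pts(4,6) d(5) l(2)] join_eqI[OF pts(1,3) d(2) l(1)]
      on sS aa' ab' a'b bb' bc' b'c cc' c'' a'' by auto
  \<comment> \<open>Two points of a line are joined to a point off it by different lines.\<close>
  have jl: "join \<P> P Q \<noteq> join \<P> P R" if "P \<in> points \<P>" "Q \<in> points \<P>" "R \<in> points \<P>" "Q \<noteq> R" "k \<in> lines \<P>"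
     "inc \<P> Q k" "inc \<P> R k" "\<not> inc \<P> P k" for P Q R k
    using that line_unique[of Q R k "join \<P> P Q"] join_line[of P Q] join_line[of P R] by metis
  have nc: "\<not> collinear3 \<P> S A' C'"
    using collinear3_iff_inc_join[OF pts(4,6) d(5), of S] collinear3_perms(3)[of \<P> A' C' S] e(8) Sl' by simp
  have nc': "\<not> collinear3 \<P> B' C'' A''"
  proof
    assume "collinear3 \<P> B' C'' A''"
    then have "inc \<P> A'' (join \<P> B' A)"
      using collinear3_iff_inc_join[OF pts(5) c''(2) ne(6)] e(6) by (simp add: join_commute)
    then have "join \<P> B' A = join \<P> B' C"
      using join_eqI[OF pts(5) a''(2) ne(7) ab'(1)] e(7) ab' by (simp add: join_commute)
    then show False using jl[OF pts(5,1,3) d(2) l(1) on(1,3) off(5)] by simp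
  qed
  have lines3: "join \<P> B B' \<noteq> join \<P> A' B" "join \<P> B B' \<noteq> join \<P> B C'" "join \<P> A' B \<noteq> join \<P> B C'"
    using jl[OF pts(2,5,4) _ l(2) on(5,4) off(2)] jl[OF pts(2,5,6) _ l(2) on(5,6) off(2)] jl[OF pts(2,4,6) _ l(2) on(4,6) off(2)]
      d by (auto simp: join_commute)
  have cp: "centrally_perspective \<P> S A' C' B' C'' A'' B"
    unfolding centrally_perspective_def e
    using S(1) pts c''(2) a''(2) nc nc' ne n lines3 bb' a'b bc' by auto
  have x: "meet \<P> (join \<P> S A') (join \<P> B' C'') = A"
    unfolding e by (rule meet_eqI) (use jl[OF pts(1,4,5) d(4) l(2) on(4,5) off(1)] aa' ab' pts in auto)
  have y: "meet \<P> (join \<P> S C') (join \<P> B' A'') = C"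
    unfolding e by (rule meet_eqI) (use jl[OF pts(3,5,6) d(6) l(2) on(5,6) off(3)] cc' b'c pts in \<open>auto simp: join_commute\<close>)
  have "collinear3 \<P> B A C" "collinear3 \<P> B' A' C'"
    using l on by (auto simp: collinear3_def)
  then have z: "inc \<P> (meet \<P> l' (join \<P> C'' A'')) l"
    using wLD[unfolded wLD_def Let_def, rule_format, OF cp] unfolding x y by (simp add: e)
  have "C'' \<noteq> A''"
    using nc' collinear3_def c''(2,3) ab' by metis
  note ca = join_line[OF c''(2) a''(2) this]
  have "l' \<noteq> join \<P> C'' A''" using ca c'' by auto
  note m = meet_point[OF l(2) ca(1) this]
  have "M = meet \<P> l' (join \<P> C'' A'')"
    using meet_eqI[OF l m(1) z m(2)] M_def by simp
  then have "collinear3 \<P> M C'' A''" using m ca unfolding collinear3_def by metis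
  then show "collinear3 \<P> (meet \<P> l l') (meet \<P> (join \<P> A B') (join \<P> A' B)) (meet \<P> (join \<P> B C') (join \<P> B' C))"
    unfolding M_def C''_def A''_def .
qed

section \<open>Little-Pappus\<close>

text \<open>Under the hypothesis of (LP) the three lines \<open>AA'\<close>, \<open>BB'\<close>, \<open>CC'\<close> are concurrent: if \<open>C'\<close>
  is replaced by the point \<open>D\<close> where \<open>SC\<close> meets the second line, (sPP) gives the
  same cross point \<open>A''\<close>, and \<open>BA''\<close> meets the second line only once.\<close>

lemma sPP_imp_LP:
  assumes sPP: "sPP \<P>"
  shows "LP \<P>"
  unfolding LP_def Let_def
proof (intro allI impI)
  fix l l' A B C A' B' C'
  assume ps: "pappus_setting \<P> l l' A B C A' B' C'"
  define M where "M = meet \<P> l l'"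
  define C'' where "C'' = meet \<P> (join \<P> A B') (join \<P> A' B)"
  define B'' where "B'' = meet \<P> (join \<P> A C') (join \<P> A' C)"
  define A'' where "A'' = meet \<P> (join \<P> B C') (join \<P> B' C)"
  assume "collinear3 \<P> (meet \<P> (join \<P> A B') (join \<P> A' B)) (meet \<P> (join \<P> B C') (join \<P> B' C)) (meet \<P> l l')"
  then have axis: "collinear3 \<P> C'' A'' M" unfolding M_def C''_def A''_def .
  have l: "l \<in> lines \<P>" "l' \<in> lines \<P>" "l \<noteq> l'"
    and pts: "A \<in> points \<P>" "B \<in> points \<P>" "C \<in> points \<P>" "A' \<in> points \<P>" "B' \<in> points \<P>" "C' \<in> points \<P>"
    and d: "A \<noteq> B" "A \<noteq> C" "B \<noteq> C" "A' \<noteq> B'" "A' \<noteq> C'" "B' \<noteq> C'"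
    and on: "inc \<P> A l" "inc \<P> B l" "inc \<P> C l" "inc \<P> A' l'" "inc \<P> B' l'" "inc \<P> C' l'"
    using ps by (auto simp: pappus_setting_def)
  note off = pappus_points_off[OF ps]
  note M = pappus_lines_meet[OF ps, folded M_def]
  have n: "A \<noteq> A'" "A \<noteq> B'" "A' \<noteq> B" "B \<noteq> B'" "B \<noteq> C'" "B' \<noteq> C" "C \<noteq> C'" using on off by auto
  note aa' = join_line[OF pts(1,4) n(1)] and bb' = join_line[OF pts(2,5) n(4)]
    and bc' = join_line[OF pts(2,6) n(5)] and b'c = join_line[OF pts(5,3) n(6)]
  note c'' = cross_joins[OF l(1,2) pts(1,2,4,5) d(1,4) on(1,2,4,5) off(1,2,4,5) C''_def]
  note a'' = cross_joins[OF l(1,2) pts(2,3,5,6) d(3,6) on(2,3,5,6) off(2,3,5,6) A''_def]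
  have MC'': "M \<noteq> C''" using M c'' by auto
  define m where "m = join \<P> M C''"
  note m = join_line[OF M(1) c''(2) MC'', folded m_def]
  have A''m: "inc \<P> A'' m"
    using axis collinear3_iff_inc_join[OF M(1) c''(2) MC''] unfolding m_def by (simp add: collinear3_perms)
  have sides: "join \<P> A A' \<noteq> join \<P> B B'"
    using line_unique[OF pts(1,2) d(1) l(1) aa'(1)] aa' bb' on off by metis
  define S where "S = meet \<P> (join \<P> A A') (join \<P> B B')"
  note S = meet_point[OF aa'(1) bb'(1) sides, folded S_def]
  have Sl: "\<not> inc \<P> S l"
    using transversal_meets_line_once[OF l(1) aa'(1) pts(1) S(1) on(1) _ aa'(2) S(2) aa'(3) off(4)]
      transversal_meets_line_once[OF l(1) bb'(1) pts(2) S(1) on(2) _ bb'(2) S(3) bb'(3) off(5)] d by auto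
  have Sl': "\<not> inc \<P> S l'"
    using transversal_meets_line_once[OF l(2) aa'(1) pts(4) S(1) on(4) _ aa'(3) S(2) aa'(2) off(1)]
      transversal_meets_line_once[OF l(2) bb'(1) pts(5) S(1) on(5) _ bb'(3) S(3) bb'(2) off(2)] d by auto
  have SC: "S \<noteq> C" using Sl on by auto
  note sc = join_line[OF S(1) pts(3) SC]
  have "join \<P> S C \<noteq> l'" using sc off by auto
  \<comment> \<open>The candidate for \<open>C'\<close> that makes the perspectivity from \<open>S\<close> true by construction.\<close>
  define D where "D = meet \<P> (join \<P> S C) l'"
  note D = meet_point[OF sc(1) l(2) \<open>join \<P> S C \<noteq> l'\<close>, folded D_def]
  have Dl: "\<not> inc \<P> D l"
    using transversal_meets_line_once[OF l(1) sc(1) pts(3) D(1) on(3) _ sc(3) D(2) sc(2) Sl] D off by metis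
  have DA': "D \<noteq> A'"
    using transversal_meets_line_once[OF aa'(1) sc(1) S(1) D(1) S(2) _ sc(2) D(2) sc(3)] aa' D(3) Sl'
      line_unique[OF pts(1,3) d(2) l(1) aa'(1)] on off by metis
  have DB': "D \<noteq> B'"
    using transversal_meets_line_once[OF bb'(1) sc(1) S(1) D(1) S(3) _ sc(2) D(2) sc(3)] bb' D(3) Sl'
      line_unique[OF pts(2,3) d(3) l(1) bb'(1)] on off by metis
  have psD: "pappus_setting \<P> l l' A B C A' B' D"
    using ps D DA' DB' Dl M unfolding pappus_setting_def M_def[symmetric] by auto
  have "\<exists>S\<in>points \<P>. collinear3 \<P> S A A' \<and> collinear3 \<P> S B B' \<and> collinear3 \<P> S C D"
    using S sc D aa' bb' unfolding collinear3_def by blast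
  then have colD: "collinear3 \<P> M C'' (meet \<P> (join \<P> B D) (join \<P> B' C))"
    using sPP[unfolded sPP_def Let_def, rule_format, OF psD] M_def C''_def by simp
  define E where "E = meet \<P> (join \<P> B D) (join \<P> B' C)"
  note E = cross_joins[OF l(1,2) pts(2,3,5) D(1) d(3) DB'[symmetric] on(2,3,5) D(3) off(2,3,5) Dl E_def]
  have Em: "inc \<P> E m"
    using colD collinear3_iff_inc_join[OF M(1) c''(2) MC''] unfolding m_def E_def by simp
  have "B \<noteq> D" using D off by auto
  note bd = join_line[OF pts(2) D(1) this]
  have "m \<noteq> join \<P> B' C"
    using transversal_meets_line_once[OF l(1) b'c(1) pts(3) M(1) on(3) M(2) b'c(3) _ b'c(2) off(5)] M off m by auto
  then have "E = A''" using line_unique[OF E(2) a''(2) _ m(1) b'c(1)] Em A''m E a'' by auto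
  have "B \<noteq> A''" using a'' on by auto
  then have "join \<P> B D = join \<P> B C'"
    using line_unique[OF pts(2) a''(2) _ bd(1) bc'(1)] E \<open>E = A''\<close> a'' bd bc' by auto
  then have "D = C'"
    using line_unique[OF D(1) pts(6) _ bd(1) l(2)] bd bc' D on off by metis
  \<comment> \<open>(sPP) again, with the indices of \<open>A\<close> and \<open>B\<close> exchanged, so that \<open>B''\<close> becomes a cross
    point next to \<open>C''\<close>.\<close>
  then have "\<exists>S\<in>points \<P>. collinear3 \<P> S B B' \<and> collinear3 \<P> S A A' \<and> collinear3 \<P> S C C'"
    using S sc D aa' bb' unfolding collinear3_def by blast
  moreover have "meet \<P> (join \<P> B A') (join \<P> B' A) = C''"
    by (simp add: C''_def meet_def join_commute conj_commute)
  ultimately have "collinear3 \<P> M C'' B''"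
    using sPP[unfolded sPP_def Let_def, rule_format, OF pappus_swap[OF ps]] M_def B''_def by auto
  then have "inc \<P> B'' m"
    using collinear3_iff_inc_join[OF M(1) c''(2) MC''] unfolding m_def by simp
  then have "collinear3 \<P> C'' B'' A''" using m A''m unfolding collinear3_def by blast
  then show "collinear3 \<P> (meet \<P> (join \<P> A B') (join \<P> A' B)) (meet \<P> (join \<P> A C') (join \<P> A' C))
     (meet \<P> (join \<P> B C') (join \<P> B' C))" unfolding A''_def B''_def C''_def .
qed

end

section \<open>Desargues' theorem in homogeneous coordinates\<close>

text \<open>Points and lines are represented by nonzero vectors of \<open>\<real>\<^sup>3\<close>, incidence by orthogonality.
  Surjectivity up to scalars is what allows the points \<open>X, Y, Z\<close> to be found from
  linear combinations instead of solving for intersections.\<close>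

locale homogeneous_coordinates = plane_of_incidence \<P>
  for \<P> :: "('p, 'l) incidence_structure" +
  fixes pt :: "'p \<Rightarrow> real^3" and ln :: "'l \<Rightarrow> real^3"
  assumes ln_nonzero: "l \<in> lines \<P> \<Longrightarrow> ln l \<noteq> 0"
    and pt_nonzero: "P \<in> points \<P> \<Longrightarrow> pt P \<noteq> 0"
    and inc_iff: "\<lbrakk>P \<in> points \<P>; l \<in> lines \<P>\<rbrakk> \<Longrightarrow> inc \<P> P l \<longleftrightarrow> ln l \<bullet> pt P = 0"
    and pt_onto: "v \<noteq> 0 \<Longrightarrow> \<exists>P\<in>points \<P>. \<exists>t. v = t *\<^sub>R pt P"
begin

text \<open>Injectivity of the coordinates is not an axiom: proportional vectors are orthogonal to the same
  lines, and in a plane two points on the same lines coincide.\<close>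

lemma independent_if_distinct:
  assumes "P \<in> points \<P>" "Q \<in> points \<P>" "P \<noteq> Q" and eq: "\<alpha> *\<^sub>R pt P + \<beta> *\<^sub>R pt Q = 0"
  shows "\<alpha> = 0" "\<beta> = 0"
proof -
  have "\<beta> = 0"
  proof (rule ccontr)
    assume \<beta>: "\<beta> \<noteq> 0"
    \<comment> \<open>The join of \<open>P\<close> with a point \<open>R\<close> off the line \<open>PQ\<close> would have to contain \<open>Q\<close>, too.\<close>
    obtain R where R: "R \<in> points \<P>" "\<not> inc \<P> R (join \<P> P Q)"
      using quadrangle join_line[OF assms(1-3)] unfolding collinear3_def by metis
    have PR: "P \<noteq> R" using R join_line[OF assms(1-3)] by auto
    note j = join_line[OF assms(1) R(1) PR]
    have "\<beta> * (ln (join \<P> P R) \<bullet> pt Q) = ln (join \<P> P R) \<bullet> (\<alpha> *\<^sub>R pt P + \<beta> *\<^sub>R pt Q)"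
      using inc_iff[OF assms(1) j(1)] j(2) by (simp add: inner_add_right)
    then have "inc \<P> Q (join \<P> P R)" using eq \<beta> inc_iff[OF assms(2) j(1)] by simp
    then show False
      using line_unique[OF assms(1-3) j(1) join_line(1)[OF assms(1-3)]] j R join_line[OF assms(1-3)] by auto
  qed
  moreover from this have "\<alpha> = 0" using eq pt_nonzero[OF assms(1)] by simp
  ultimately show "\<alpha> = 0" "\<beta> = 0" by auto
qed

text \<open>The three vectors lie in the plane orthogonal to the line, so they are dependent. No coefficient
  of the relation vanishes, because any two of the vectors are independent.\<close>

lemma combination_on_line:
  assumes pts: "P \<in> points \<P>" "Q \<in> points \<P>" "R \<in> points \<P>" and d: "P \<noteq> Q" "P \<noteq> R" "Q \<noteq> R"
    and l: "l \<in> lines \<P>" "inc \<P> P l" "inc \<P> Q l" "inc \<P> R l"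
  obtains \<alpha> \<beta> where "\<alpha> \<noteq> 0" "\<beta> \<noteq> 0" "pt R = \<alpha> *\<^sub>R pt P + \<beta> *\<^sub>R pt Q"
proof -
  have inj: "pt U \<noteq> pt V" if "U \<in> points \<P>" "V \<in> points \<P>" "U \<noteq> V" for U V
    using independent_if_distinct[OF that, of 1 "-1"] by auto
  let ?T = "{pt P, pt Q, pt R}"
  have c: "card ?T = 3" using inj pts d by simp
  have "?T \<subseteq> {x. ln l \<bullet> x = 0}" using inc_iff pts l by simp
  then have "dim ?T \<le> dim {x. ln l \<bullet> x = 0}" by (rule dim_subset)
  also have "\<dots> = 2" using dim_hyperplane[OF ln_nonzero[OF l(1)]] by simp
  finally have "dependent ?T" using c by (intro dependent_biggerset_general) simp
  then obtain u where u: "(\<Sum>v\<in>?T. u v *\<^sub>R v) = 0" "\<exists>v\<in>?T. u v \<noteq> 0"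
    using dependent_finite[of ?T] by auto
  define a b c where abc: "a = u (pt P)" "b = u (pt Q)" "c = u (pt R)"
  have sum: "a *\<^sub>R pt P + b *\<^sub>R pt Q + c *\<^sub>R pt R = 0" and nz: "a \<noteq> 0 \<or> b \<noteq> 0 \<or> c \<noteq> 0"
    using u inj pts d by (auto simp: abc add.assoc)
  have a: "a \<noteq> 0" using independent_if_distinct[OF pts(2,3) d(3), of b c] sum nz by auto
  have b: "b \<noteq> 0" using independent_if_distinct[OF pts(1,3) d(2), of a c] sum nz by auto
  have c: "c \<noteq> 0" using independent_if_distinct[OF pts(1,2) d(1), of a b] sum nz by auto
  have cR: "c *\<^sub>R pt R = - (a *\<^sub>R pt P + b *\<^sub>R pt Q)" using iffD1[OF add_eq_0_iff sum] .
  have "pt R = (1/c) *\<^sub>R c *\<^sub>R pt R" using c by simp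
  also have "\<dots> = (-a/c) *\<^sub>R pt P + (-b/c) *\<^sub>R pt Q" unfolding cR by (simp add: scaleR_diff_right)
  finally have "pt R = (-a/c) *\<^sub>R pt P + (-b/c) *\<^sub>R pt Q" .
  then show thesis using that[of "-a/c" "-b/c"] a b c by simp
qed

text \<open>Both expressions for \<open>s\<close> give \<open>\<alpha> a - \<beta> b = \<beta>' b' - \<alpha>' a'\<close>, so this vector is
  orthogonal to the line \<open>AB\<close> as well as to the line \<open>A'B'\<close>.\<close>

lemma axis_point_vector:
  assumes cp: "centrally_perspective \<P> A B C A' B' C' S"
    and nz: "\<alpha> \<noteq> 0"
    and S: "pt S = \<alpha> *\<^sub>R pt A + \<alpha>' *\<^sub>R pt A'" "pt S = \<beta> *\<^sub>R pt B + \<beta>' *\<^sub>R pt B'"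
  obtains t where "t \<noteq> 0"
    "\<alpha> *\<^sub>R pt A - \<beta> *\<^sub>R pt B = t *\<^sub>R pt (meet \<P> (join \<P> A B) (join \<P> A' B'))"
proof -
  note cp' = perspective_permute(4)[OF cp]
  have pts: "A \<in> points \<P>" "B \<in> points \<P>" "A' \<in> points \<P>" "B' \<in> points \<P>"
    using perspective_points[OF cp] by auto
  note j = join_line[OF pts(1,2) perspective_side(1)[OF cp]]
    and j' = join_line[OF pts(3,4) perspective_side(1)[OF cp']]
  define x where "x = \<alpha> *\<^sub>R pt A - \<beta> *\<^sub>R pt B"
  have x': "x = \<beta>' *\<^sub>R pt B' - \<alpha>' *\<^sub>R pt A'" using S unfolding x_def by (simp add: algebra_simps)
  have x0: "x \<noteq> 0"
    using independent_if_distinct[OF pts(1,2) perspective_side(1)[OF cp], of \<alpha> "-\<beta>"] nz by (auto simp: x_def)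
  then obtain X t where X: "X \<in> points \<P>" "x = t *\<^sub>R pt X" using pt_onto by blast
  have t: "t \<noteq> 0" using x0 X by auto
  have "ln (join \<P> A B) \<bullet> x = 0"
    using inc_iff[OF pts(1) j(1)] inc_iff[OF pts(2) j(1)] j unfolding x_def by (simp add: inner_diff_right)
  then have 1: "inc \<P> X (join \<P> A B)" using t X inc_iff[OF X(1) j(1)] by simp
  have "ln (join \<P> A' B') \<bullet> x = 0"
    using inc_iff[OF pts(3) j'(1)] inc_iff[OF pts(4) j'(1)] j' unfolding x' by (simp add: inner_diff_right)
  then have 2: "inc \<P> X (join \<P> A' B')" using t X inc_iff[OF X(1) j'(1)] by simp
  have "meet \<P> (join \<P> A B) (join \<P> A' B') = X"
    using meet_eqI[OF j(1) j'(1) _ X(1) 1 2] perspective_axis_point[OF cp refl] by simp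
  then show thesis using that[OF t] X(2) by (simp add: x_def)
qed

text \<open>The same coefficients \<open>\<alpha>, \<beta>, \<gamma>\<close> serve for all three pairs of sides, so the vectors of
  \<open>X, Y, Z\<close> satisfy a linear relation in which \<open>Z\<close> occurs with nonzero coefficient.\<close>

lemma desargues:
  assumes cp: "centrally_perspective \<P> A B C A' B' C' S"
  shows "inc \<P> (meet \<P> (join \<P> B C) (join \<P> B' C'))
     (join \<P> (meet \<P> (join \<P> A B) (join \<P> A' B')) (meet \<P> (join \<P> A C) (join \<P> A' C')))"
    (is "inc \<P> ?Z (join \<P> ?X ?Y)")
proof -
  note cpC = perspective_permute(1)[OF cp] and cpBC = perspective_permute(3)[OF cp]
  have pts: "A \<in> points \<P>" "B \<in> points \<P>" "C \<in> points \<P>" "A' \<in> points \<P>" "B' \<in> points \<P>"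
    "C' \<in> points \<P>" "S \<in> points \<P>" using perspective_points[OF cp] by auto
  have d: "A \<noteq> A'" "B \<noteq> B'" "C \<noteq> C'" "A \<noteq> S" "B \<noteq> S" "C \<noteq> S" "A' \<noteq> S" "B' \<noteq> S" "C' \<noteq> S"
     and S: "inc \<P> S (join \<P> A A')" "inc \<P> S (join \<P> B B')" "inc \<P> S (join \<P> C C')"
    using cp by (auto simp: centrally_perspective_def)
  obtain \<alpha> \<alpha>' where a: "\<alpha> \<noteq> 0" "\<alpha>' \<noteq> 0" "pt S = \<alpha> *\<^sub>R pt A + \<alpha>' *\<^sub>R pt A'"
    using combination_on_line[OF pts(1,4,7) d(1,4,7) join_line[OF pts(1,4) d(1)] S(1)] by blast
  obtain \<beta> \<beta>' where b: "\<beta> \<noteq> 0" "\<beta>' \<noteq> 0" "pt S = \<beta> *\<^sub>R pt B + \<beta>' *\<^sub>R pt B'"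
    using combination_on_line[OF pts(2,5,7) d(2,5,8) join_line[OF pts(2,5) d(2)] S(2)] by blast
  obtain \<gamma> \<gamma>' where c: "\<gamma> \<noteq> 0" "\<gamma>' \<noteq> 0" "pt S = \<gamma> *\<^sub>R pt C + \<gamma>' *\<^sub>R pt C'"
    using combination_on_line[OF pts(3,6,7) d(3,6,9) join_line[OF pts(3,6) d(3)] S(3)] by blast
  obtain r where r: "r \<noteq> 0" "\<alpha> *\<^sub>R pt A - \<beta> *\<^sub>R pt B = r *\<^sub>R pt ?X"
    using axis_point_vector[OF cp a(1,3) b(3)] by blast
  obtain s where s: "s \<noteq> 0" "\<alpha> *\<^sub>R pt A - \<gamma> *\<^sub>R pt C = s *\<^sub>R pt ?Y"
    using axis_point_vector[OF cpC a(1,3) c(3)] by blast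
  obtain t where t: "t \<noteq> 0" "\<beta> *\<^sub>R pt B - \<gamma> *\<^sub>R pt C = t *\<^sub>R pt ?Z"
    using axis_point_vector[OF cpBC b(1,3) c(3)] by blast
  have rel: "t *\<^sub>R pt ?Z = s *\<^sub>R pt ?Y - r *\<^sub>R pt ?X"
    unfolding r(2)[symmetric] s(2)[symmetric] t(2)[symmetric] by simp
  have X: "?X \<in> points \<P>" and Y: "?Y \<in> points \<P>" and Z: "?Z \<in> points \<P>"
    using perspective_axis_point(2)[OF cp refl] perspective_axis_point(2)[OF cpC refl]
      perspective_axis_point(2)[OF cpBC refl] by auto
  note j = join_line[OF X Y perspective_axis_points_distinct[OF cp]]
  have "t * (ln (join \<P> ?X ?Y) \<bullet> pt ?Z) = ln (join \<P> ?X ?Y) \<bullet> (t *\<^sub>R pt ?Z)" by simp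
  also have "\<dots> = 0"
    using inc_iff[OF X j(1)] inc_iff[OF Y j(1)] j unfolding rel by (simp add: inner_diff_right)
  finally show ?thesis using t inc_iff[OF Z j(1)] by simp
qed

lemma LD_holds: "LD \<P>"
  unfolding LD_def Let_def by (intro allI impI) (rule desargues)

end

section \<open>Coordinates of the real projective plane\<close>

text \<open>A point at infinity gets the direction of its lines as coordinates, and the line
  \<open>a x + b y = c\<close> gets \<open>(a, b, -c)\<close>. Both vectors depend on an equation for a line, which is unique
  only up to a factor; a choice operator selects one.\<close>

definition point_vector :: "ext_point \<Rightarrow> real^3" where
  "point_vector P = (SOME v. case P of
     Proper p \<Rightarrow> v = vector [p$1, p$2, 1]
   | Ideal c \<Rightarrow> \<exists>a b d. c = parallel_class (Ln a b d) \<and> (a \<noteq> 0 \<or> b \<noteq> 0) \<and> v = vector [-b, a, 0])"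

definition line_vector :: "ext_line \<Rightarrow> real^3" where
  "line_vector l = (SOME w. case l of
     Extended m \<Rightarrow> \<exists>a b c. m = Ln a b c \<and> (a \<noteq> 0 \<or> b \<noteq> 0) \<and> w = vector [a, b, -c]
   | Line_at_infinity \<Rightarrow> w = vector [0, 0, 1])"

lemma point_vector_Proper: "point_vector (Proper p) = vector [p$1, p$2, 1]"
  by (simp add: point_vector_def)

lemma line_vector_infinity: "line_vector Line_at_infinity = vector [0, 0, 1]"
  by (simp add: line_vector_def)

lemma point_vector_Ideal:
  assumes "k \<in> euclidean_lines"
  obtains a b d where "parallel_class k = parallel_class (Ln a b d)" "a \<noteq> 0 \<or> b \<noteq> 0"
    "point_vector (Ideal (parallel_class k)) = vector [-b, a, 0]"
proof -
  let ?Q = "\<lambda>v::real^3. \<exists>a b d. parallel_class k = parallel_class (Ln a b d) \<and> (a \<noteq> 0 \<or> b \<noteq> 0) \<and> v = vector [-b, a, 0]"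
  have "\<exists>v. ?Q v" using assms unfolding euclidean_lines_Ln by blast
  then have "?Q (SOME v. ?Q v)" by (rule someI_ex)
  then show thesis using that by (auto simp: point_vector_def)
qed

lemma line_vector_Extended:
  assumes "m \<in> euclidean_lines"
  obtains a b c where "m = Ln a b c" "a \<noteq> 0 \<or> b \<noteq> 0" "line_vector (Extended m) = vector [a, b, -c]"
proof -
  let ?Q = "\<lambda>w::real^3. \<exists>a b c. m = Ln a b c \<and> (a \<noteq> 0 \<or> b \<noteq> 0) \<and> w = vector [a, b, -c]"
  have "\<exists>w. ?Q w" using assms unfolding euclidean_lines_Ln by blast
  then have "?Q (SOME w. ?Q w)" by (rule someI_ex)
  then show thesis using that by (auto simp: line_vector_def)
qed

lemma real_projective_plane_sel:
  "points real_projective_plane = range Proper \<union> Ideal ` parallel_class ` euclidean_lines"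
  "lines real_projective_plane = insert Line_at_infinity (Extended ` euclidean_lines)"
  "inc real_projective_plane = ext_inc"
  by (simp_all add: real_projective_plane_def)

lemma vec3_eq: "(x::real^3) = y \<longleftrightarrow> x$1 = y$1 \<and> x$2 = y$2 \<and> x$3 = y$3"
  by (simp add: vec_eq_iff forall_3)

lemma line_vector_nonzero:
  assumes "l \<in> lines real_projective_plane"
  shows "line_vector l \<noteq> 0"
proof (cases l)
  case (Extended m)
  then have "m \<in> euclidean_lines" using assms by (auto simp: real_projective_plane_sel)
  then show ?thesis by (rule line_vector_Extended) (auto simp: Extended vec3_eq)
qed (simp add: line_vector_infinity vec3_eq)

lemma point_vector_nonzero:
  assumes "P \<in> points real_projective_plane"
  shows "point_vector P \<noteq> 0"
proof (cases P)
  case (Ideal c)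
  then obtain k where "k \<in> euclidean_lines" "c = parallel_class k"
    using assms by (auto simp: real_projective_plane_sel)
  then obtain a b where "a \<noteq> 0 \<or> b \<noteq> 0" "point_vector P = vector [-b, a, 0]"
    using point_vector_Ideal[of k] Ideal by metis
  then show ?thesis by (auto simp: vec3_eq)
qed (simp add: point_vector_Proper vec3_eq)

lemma ext_inc_iff_orthogonal:
  assumes P: "P \<in> points real_projective_plane" and l: "l \<in> lines real_projective_plane"
  shows "ext_inc P l \<longleftrightarrow> line_vector l \<bullet> point_vector P = 0"
proof (cases l)
  case (Extended m)
  then have "m \<in> euclidean_lines" using l by (auto simp: real_projective_plane_sel)
  then obtain a b c where m: "m = Ln a b c" "a \<noteq> 0 \<or> b \<noteq> 0" and lv: "line_vector l = vector [a, b, -c]"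
    using line_vector_Extended Extended by metis
  show ?thesis
  proof (cases P)
    case (Proper p)
    then have "ext_inc P l \<longleftrightarrow> a * p$1 + b * p$2 = c" by (simp add: Extended m(1) Ln_def)
    then show ?thesis unfolding lv Proper point_vector_Proper by (auto simp: inner_vec_def sum_3)
  next
    case (Ideal C)
    then obtain k where k: "k \<in> euclidean_lines" "C = parallel_class k"
      using P by (auto simp: real_projective_plane_sel)
    obtain a' b' d' where k': "C = parallel_class (Ln a' b' d')" "a' \<noteq> 0 \<or> b' \<noteq> 0"
      and pv: "point_vector P = vector [-b', a', 0]"
      using point_vector_Ideal[OF k(1)] k(2) Ideal by metis
    have "ext_inc P l \<longleftrightarrow> a' * b = a * b'"
      using Ln_mem_parallel_class[OF k'(2) m(2)] by (simp add: Extended Ideal m(1) k'(1))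
    then show ?thesis unfolding lv pv by (auto simp: inner_vec_def sum_3 mult.commute)
  qed
next
  case Line_at_infinity
  show ?thesis
  proof (cases P)
    case (Proper p)
    then show ?thesis unfolding Line_at_infinity Proper point_vector_Proper line_vector_infinity
      by (simp add: inner_vec_def sum_3)
  next
    case (Ideal C)
    then obtain k where k: "k \<in> euclidean_lines" "C = parallel_class k"
      using P by (auto simp: real_projective_plane_sel)
    obtain a' b' d' where "point_vector P = vector [-b', a', 0]"
      using point_vector_Ideal[OF k(1)] k(2) Ideal by metis
    then show ?thesis unfolding Line_at_infinity line_vector_infinity
      by (simp add: Ideal inner_vec_def sum_3)
  qed
qed

lemma point_vector_onto:
  assumes "v \<noteq> 0"
  shows "\<exists>P\<in>points real_projective_plane. \<exists>t. v = t *\<^sub>R point_vector P"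
proof (cases "v$3 = 0")
  case False
  let ?p = "vector [v$1 / v$3, v$2 / v$3] :: real^2"
  have "v = v$3 *\<^sub>R point_vector (Proper ?p)"
    using False by (simp add: point_vector_Proper vec3_eq)
  then show ?thesis by (auto simp: real_projective_plane_sel)
next
  case True
  then have n: "v$2 \<noteq> 0 \<or> - v$1 \<noteq> 0" using assms by (auto simp: vec3_eq)
  let ?k = "Ln (v$2) (- v$1) 0"
  have k: "?k \<in> euclidean_lines" using n unfolding euclidean_lines_Ln by blast
  obtain a b d where ab: "parallel_class ?k = parallel_class (Ln a b d)" "a \<noteq> 0 \<or> b \<noteq> 0"
    "point_vector (Ideal (parallel_class ?k)) = vector [-b, a, 0]"
    using point_vector_Ideal[OF k] .
  have "?k \<in> parallel_class (Ln a b d)" using parallel_class_refl[OF k] ab by simp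
  then have par: "a * v$1 = - b * v$2" using Ln_mem_parallel_class[OF ab(2) n] by (simp add: mult.commute)
  \<comment> \<open>The direction chosen for the class is parallel to \<open>v\<close>; the factor is read off a nonzero entry.\<close>
  define t where "t = (if a = 0 then - v$1 / b else v$2 / a)"
  have "v = t *\<^sub>R (vector [-b, a, 0] :: real^3)"
    using True par ab(2) by (auto simp: vec3_eq t_def field_simps)
  then show ?thesis using ab(3) k unfolding real_projective_plane_sel by (metis UnI2 image_eqI)
qed

lemma homogeneous_coordinates_real_projective_plane:
  "homogeneous_coordinates real_projective_plane point_vector line_vector"
  by (intro homogeneous_coordinates.intro homogeneous_coordinates_axioms.intro
      plane_of_incidence_real_projective_plane line_vector_nonzero point_vector_nonzero point_vector_onto)
     (simp_all add: real_projective_plane_sel(3) ext_inc_iff_orthogonal)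

theorem theorem1:
  "(\<forall>\<P> :: ('p, 'l) incidence_structure. plane_of_incidence \<P> \<longrightarrow>
      (HD \<P> \<longrightarrow> LD \<P>) \<and>
      (wLD \<P> \<longleftrightarrow> sPP \<P>) \<and>
      (wLD \<P> \<longrightarrow> LP \<P>)) \<and>
   (wLD real_projective_plane \<longrightarrow> LD real_projective_plane)"
proof (intro conjI allI impI)
  fix \<P> :: "('p, 'l) incidence_structure"
  assume "plane_of_incidence \<P>"
  then interpret plane_of_incidence \<P> .
  show "LD \<P>" if "HD \<P>" using HD_imp_LD that .
  show "wLD \<P> \<longleftrightarrow> sPP \<P>" using wLD_imp_sPP sPP_imp_wLD by blast
  show "LP \<P>" if "wLD \<P>" using sPP_imp_LP wLD_imp_sPP that by blast
next
  show "LD real_projective_plane"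
    using homogeneous_coordinates.LD_holds[OF homogeneous_coordinates_real_projective_plane] .
qed

end
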